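(* Let $n\ge0$ and $0\le m\le 2^n-1$, and write $\{m\}_n=1^{k_0}0^{k_1}\cdots 0^{k_{l-2}}1^{k_{l-1}}$ with $l$ odd, $k_0\ge0$, $k_i\ge1$ ($i=1,\dots,l-2$), $k_{l-1}\ge 0$. If $l\ge 3$, then (1) $[2^n:m]=[k_0,k_1,\dots,k_{l-1}]$; (2) $[2^n:2^n-m]=[k_1,k_2,\dots,k_{l-1}]$; (3) $[2^n:m+1]=[k_0,k_1,\dots,k_{l-2}]$; (4) $[2^n:2^n-(m+1)]=[k_1,k_2,\dots,k_{l-2}]$. If $l=1$, then $n=k_0$, $m=2^n-1$, and $[2^n:m]=n$, $[2^n:2^n-m]=1$, $[2^n:m+1]=1$, $[2^n:2^n-(m+1)]=0$.
   Context: Stern's diatomic integers: for integers $n\ge0$, $0\le m\le 2^n$, define $[2^0:0]=0$, $[2^0:1]=1$, $[2^{n+1}:2m]=[2^n:m]$ ($0\le m\le 2^n$), $[2^{n+1}:2m+1]=[2^n:m]+[2^n:m+1]$ ($0\le m\le 2^n-1$). For $0\le m\le 2^n-1$, $\{m\}_n$ is the binary word of length $n$ (leading zeros allowed) representing $m$ in base 2; $x^k$ denotes $k$ copies of the letter $x$. Continuant: $[x_0]=x_0$, $[x_0,x_1]=x_0x_1+1$, $[x_0,\dots,x_{l-1}]=[x_0,\dots,x_{l-2}]x_{l-1}+[x_0,\dots,x_{l-3}]$ for $l\ge3$, and $[\,]=1$ for the empty sequence. *)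

theory Defs
  imports Main
begin

text \<open>\<open>stern n m\<close> is Stern's diatomic integer $[2^n : m]$; it is meaningful only for
  \<open>m \<le> 2 ^ n\<close>, and the values outside this range are junk.\<close>

fun stern :: "nat \<Rightarrow> nat \<Rightarrow> nat" where
  "stern 0 m = (if m = 0 then 0 else 1)"
| "stern (Suc n) m =
    (if even m then stern n (m div 2) else stern n (m div 2) + stern n (m div 2 + 1))"

lemma stern_even: "stern (Suc n) (2 * m) = stern n m"
  by simp

lemma stern_odd: "stern (Suc n) (2 * m + 1) = stern n m + stern n (m + 1)"
  by simp

text \<open>\<open>bin_word n m\<close> is $\{m\}_n$, most significant digit first.\<close>

fun bin_word :: "nat \<Rightarrow> nat \<Rightarrow> nat list" where
  "bin_word 0 m = []"
| "bin_word (Suc n) m = bin_word n (m div 2) @ [m mod 2]"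

lemma length_bin_word: "length (bin_word n m) = n"
  by (induction n arbitrary: m) auto

lemma set_bin_word: "set (bin_word n m) \<subseteq> {0, 1}"
  by (induction n arbitrary: m) auto

lemma bin_word_value:
  "m < 2 ^ n \<Longrightarrow> foldl (\<lambda>v d. 2 * v + d) 0 (bin_word n m) = m"
proof (induction n arbitrary: m)
  case (Suc n)
  then have "m div 2 < 2 ^ n" by auto
  then show ?case using Suc.IH by simp
qed simp

text \<open>The word $1^{k_0} 0^{k_1} 1^{k_2} \cdots$ with \<open>l\<close> blocks.\<close>

definition block_word :: "nat \<Rightarrow> (nat \<Rightarrow> nat) \<Rightarrow> nat list" where
  "block_word l k = concat (map (\<lambda>i. replicate (k i) (if even i then 1 else 0)) [0..<l])"

function continuant :: "nat list \<Rightarrow> nat" where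
  "continuant xs =
    (if xs = [] then 1
     else if length xs = 1 then hd xs
     else continuant (butlast xs) * last xs + continuant (butlast (butlast xs)))"
  by auto
termination
  by (relation "measure length") auto

declare continuant.simps [simp del]

lemma continuant_Nil: "continuant [] = 1"
  by (simp add: continuant.simps)

lemma continuant_single: "continuant [x] = x"
  by (simp add: continuant.simps)

lemma continuant_pair: "continuant [x, y] = x * y + 1"
  by (simp add: continuant.simps [of "[x, y]"] continuant_single continuant_Nil)

lemma continuant_snoc:
  "continuant (xs @ [x, y]) = continuant (xs @ [x]) * y + continuant xs"
  by (simp add: continuant.simps [of "xs @ [x, y]"] butlast_append)

lemma block_word_exists:
  "\<exists>l k. odd l \<and> (\<forall>i\<in>{1..l - 2}. k i \<ge> 1) \<and> bin_word n m = block_word l k"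
proof (induction n arbitrary: m)
  case 0
  show ?case
    by (intro exI [of _ "1::nat"] exI [of _ "\<lambda>_. 0"]) (simp add: block_word_def)
next
  case (Suc n)
  from Suc.IH [of "m div 2"] obtain l k where l: "odd l" and k: "\<forall>i\<in>{1..l - 2}. k i \<ge> 1"
    and w: "bin_word n (m div 2) = block_word l k"
    by blast
  from l obtain p where p: "l = Suc p" "even p" by (cases l) auto
  have upd: "block_word j (k(i := x)) = block_word j k" if "j \<le> i" for i j x
    using that by (auto simp: block_word_def intro!: arg_cong [where f = concat])
  have Sucw: "block_word (Suc j) f =
      block_word j f @ replicate (f j) (if even j then 1 else 0)" for j f
    by (simp add: block_word_def)
  consider (one) "m mod 2 = 1" | (ext) q where "m mod 2 = 0" "k p = 0" "p = Suc q"
    | (new) "m mod 2 = 0" "p = 0 \<or> k p \<ge> 1"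
    by (cases "m mod 2 = 1"; cases p; cases "k p") auto
  then show ?case
  proof cases
    case one
    let ?k = "k(p := Suc (k p))"
    have "bin_word (Suc n) m = block_word l ?k"
      using one w p by (simp add: Sucw upd replicate_append_same)
    moreover have "\<forall>i\<in>{1..l - 2}. ?k i \<ge> 1" using k by auto
    ultimately show ?thesis using l by blast
  next
    case ext
    let ?k = "k(q := Suc (k q))"
    have "odd q" using p ext by simp
    then have "bin_word (Suc n) m = block_word l ?k"
      using ext w p by (simp add: Sucw upd replicate_append_same)
    moreover have "\<forall>i\<in>{1..l - 2}. ?k i \<ge> 1" using k by auto
    ultimately show ?thesis using l by blast
  next
    case new
    let ?k = "k(l := 1, Suc l := 0)"
    have "block_word l ?k = block_word l k"
      by (auto simp: block_word_def intro!: arg_cong [where f = concat])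
    then have "bin_word (Suc n) m = block_word (l + 2) ?k"
      using new(1) w l by (simp add: Sucw)
    moreover have "?k i \<ge> 1" if "i \<in> {1..l + 2 - 2}" for i
    proof -
      have "i = l \<or> i = p \<or> i \<in> {1..l - 2}" using that p by auto
      then show ?thesis using k new(2) that p by auto
    qed
    moreover have "odd (l + 2)" using l by simp
    ultimately show ?thesis by blast
  qed
qed

end

theory Submission imports Defs begin

text \<open>Appending a binary digit to $\{m\}_n$ acts linearly on the pair of neighbours
  $([2^n:m], [2^n:m+1])$: the digit 1 adds the second entry to the first, the digit 0 adds the
  first to the second. The reflected pair $([2^n:2^n-m], [2^n:2^n-(m+1)])$ obeys the same rule and
  only starts from $(1,0)$ instead of $(0,1)$. A block of \<open>k\<close> equal digits therefore adds
  \<open>k\<close> times one entry to the other, which is the continuant recurrence.\<close>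

fun digit_step :: "nat \<times> nat \<Rightarrow> nat \<Rightarrow> nat \<times> nat" where
  "digit_step (a, b) d = (if d = 0 then (a, a + b) else (a + b, b))"

text \<open>With \<open>j = m div 2\<close>, the neighbours at level \<open>Suc n\<close> are
  \<open>2j, 2j+1\<close> or \<open>2j+1, 2j+2\<close>: the even one inherits its value from level
  \<open>n\<close>, the odd one is the sum over \<open>j\<close> and \<open>j + 1\<close>.\<close>

lemma foldl_digit_step_bin_word:
  "m < 2 ^ n \<Longrightarrow> foldl digit_step (0, 1) (bin_word n m) = (stern n m, stern n (m + 1))"
proof (induction n arbitrary: m)
  case (Suc n)
  then have IH: "foldl digit_step (0, 1) (bin_word n (m div 2)) =
      (stern n (m div 2), stern n (m div 2 + 1))"
    by auto
  show ?case
  proof (cases "even m")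
    case True
    then show ?thesis using IH by simp
  next
    case False
    then obtain j where "m = 2 * j + 1" by (elim oddE)
    then show ?thesis using IH by simp
  qed
qed simp

lemma foldl_digit_step_bin_word_reflected:
  "m < 2 ^ n \<Longrightarrow> foldl digit_step (1, 0) (bin_word n m) =
    (stern n (2 ^ n - m), stern n (2 ^ n - (m + 1)))"
proof (induction n arbitrary: m)
  case (Suc n)
  define j where "j = m div 2"
  have j: "j < 2 ^ n" using Suc.prems by (auto simp: j_def)
  \<comment> \<open>Counting from the right end through \<open>r\<close> turns the truncated
    differences into \<open>2r\<close>, \<open>2r + 1\<close>, \<open>2r + 2\<close>, to which the
    recurrences apply directly.\<close>
  define r where "r = 2 ^ n - (j + 1)"
  have r: "2 ^ n - j = Suc r" "2 ^ n = j + 1 + r" using j by (simp_all add: r_def)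
  have IH: "foldl digit_step (1, 0) (bin_word n j) = (stern n (Suc r), stern n r)"
    using Suc.IH[OF j] unfolding r(1) r_def[symmetric] .
  show ?case
  proof (cases "even m")
    case True
    then have m: "m = 2 * j" by (simp add: j_def)
    have "2 ^ Suc n - m = 2 * Suc r" "2 ^ Suc n - (m + 1) = 2 * r + 1"
      using r(2) m by simp_all
    then show ?thesis using IH True
      by (simp only: stern_even stern_odd) (simp flip: j_def)
  next
    case False
    then have m: "m = 2 * j + 1" by (simp add: j_def)
    have "2 ^ Suc n - m = 2 * r + 1" "2 ^ Suc n - (m + 1) = 2 * r"
      using r(2) m by simp_all
    then show ?thesis using IH False
      by (simp only: stern_even stern_odd) (simp add: odd_iff_mod_2_eq_one flip: j_def)
  qed
qed simp

lemma foldl_digit_step_replicate: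
  "foldl digit_step (a, b) (replicate c d) = (if d = 0 then (a, b + c * a) else (a + c * b, b))"
  by (induction c arbitrary: a b) auto

lemma block_word_Suc:
  "block_word (Suc l) k = block_word l k @ replicate (k l) (if even l then 1 else 0)"
  by (simp add: block_word_def)

lemma continuant_map_upt_Suc_Suc:
  assumes "j \<le> i"
  shows "continuant (map k [j..<Suc (Suc i)]) =
    continuant (map k [j..<Suc i]) * k (Suc i) + continuant (map k [j..<i])"
  using continuant_snoc[of "map k [j..<i]" "k i" "k (Suc i)"] assms by simp

text \<open>Each block adds a multiple of the longer continuant to the shorter one, so the two swap
  roles and parity tells which entry is longer. The free start \<open>j\<close> serves both initial
  pairs.\<close>

lemma foldl_digit_step_block_word:
  assumes "j \<le> i"
    and "foldl digit_step s (block_word (Suc j) k) = (if even j then (k j, 1) else (1, k j))"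
  shows "foldl digit_step s (block_word (Suc i) k) =
    (if even i then (continuant (map k [j..<Suc i]), continuant (map k [j..<i]))
     else (continuant (map k [j..<i]), continuant (map k [j..<Suc i])))"
  using assms(1)
proof (induction i rule: dec_induct)
  case base
  then show ?case using assms(2) by (simp add: continuant_single continuant_Nil)
next
  case (step i)
  have "foldl digit_step s (block_word (Suc (Suc i)) k) =
      foldl digit_step (foldl digit_step s (block_word (Suc i) k))
        (replicate (k (Suc i)) (if odd i then 1 else 0))"
    by (subst block_word_Suc) simp
  then show ?case
    using step.IH continuant_map_upt_Suc_Suc[OF step.hyps(1), of k]
    by (simp add: foldl_digit_step_replicate mult.commute del: upt_Suc)
qed

lemma foldl_binary_replicate_one:
  "foldl (\<lambda>v d. 2 * v + d) 0 (replicate n 1) = (2::nat) ^ n - 1"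
proof (induction n)
  case (Suc n)
  \<comment> \<open>The extra digit is split off at the right, where \<open>foldl\<close> reads it
    last.\<close>
  have "replicate (Suc n) (1::nat) = replicate n 1 @ [1]"
    by (simp add: replicate_append_same)
  then have "foldl (\<lambda>v d. 2 * v + d) 0 (replicate (Suc n) 1) = 2 * ((2::nat) ^ n - 1) + 1"
    using Suc.IH by (simp del: replicate_Suc)
  also have "\<dots> = 2 ^ Suc n - 1"
    using one_le_power[of "2::nat" n] unfolding power_Suc by linarith
  finally show ?case .
qed simp

theorem theorem4p4:
  fixes n m l :: nat and k :: "nat \<Rightarrow> nat"
  assumes "m \<le> 2 ^ n - 1"
    and "odd l"
    and "\<forall>i\<in>{1..l - 2}. k i \<ge> 1"
    and "bin_word n m = block_word l k"
  shows "(l \<ge> 3 \<longrightarrow>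
           stern n m = continuant (map k [0..<l]) \<and>
           stern n (2 ^ n - m) = continuant (map k [1..<l]) \<and>
           stern n (m + 1) = continuant (map k [0..<l - 1]) \<and>
           stern n (2 ^ n - (m + 1)) = continuant (map k [1..<l - 1])) \<and>
         (l = 1 \<longrightarrow>
           n = k 0 \<and> m = 2 ^ n - 1 \<and>
           stern n m = n \<and>
           stern n (2 ^ n - m) = 1 \<and>
           stern n (m + 1) = 1 \<and>
           stern n (2 ^ n - (m + 1)) = 0)"
proof (intro conjI[of "_ \<longrightarrow> _"] impI)
  have m: "m < 2 ^ n"
    using assms(1) by (metis Suc_pred' less_Suc_eq_le zero_less_numeral zero_less_power)
  note pair = foldl_digit_step_bin_word[OF m, unfolded assms(4)]
  note reflected = foldl_digit_step_bin_word_reflected[OF m, unfolded assms(4)]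
  {
    assume "l \<ge> 3"
    then obtain p where p: "l = Suc p" "1 \<le> p" by (cases l) auto
    have p_even: "even p" using p assms(2) by simp
    have "foldl digit_step (0, 1) (block_word (Suc 0) k) = (k 0, 1)"
      by (simp add: block_word_def foldl_digit_step_replicate)
    \<comment> \<open>The leading ones fix \<open>(1, 0)\<close>, so \<open>k 0\<close> drops out
      and the reflected continuants start at index 1.\<close>
    moreover have "foldl digit_step (1, 0) (block_word (Suc 1) k) = (1, k 1)"
      by (simp add: block_word_def foldl_digit_step_replicate)
    ultimately show "stern n m = continuant (map k [0..<l]) \<and>
        stern n (2 ^ n - m) = continuant (map k [1..<l]) \<and>
        stern n (m + 1) = continuant (map k [0..<l - 1]) \<and>
        stern n (2 ^ n - (m + 1)) = continuant (map k [1..<l - 1])"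
      \<comment> \<open>The last index \<open>p = l - 1\<close> is even, so the first entry of each
        pair is the longer continuant.\<close>
      using pair reflected p p_even
        foldl_digit_step_block_word[of 0 p "(0, 1)" k]
        foldl_digit_step_block_word[of 1 p "(1, 0)" k]
      by (simp del: upt_Suc)
  }
  {
    assume "l = 1"
    then have word: "block_word l k = replicate (k 0) 1" by (simp add: block_word_def)
    then have n: "n = k 0" using assms(4) length_bin_word[of n m] by simp
    \<comment> \<open>The word consists of \<open>n\<close> ones, and \<open>m < 2 ^ n\<close> makes
      \<open>m\<close> its binary value.\<close>
    have "m = 2 ^ n - 1"
      using bin_word_value[OF m, unfolded assms(4) word] foldl_binary_replicate_one[of "k 0"]
      unfolding n by simp
    moreover have "(stern n m, stern n (m + 1)) = (n, 1)"
      unfolding pair[symmetric] word foldl_digit_step_replicate by (simp add: n)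
    moreover have "(stern n (2 ^ n - m), stern n (2 ^ n - (m + 1))) = (1, 0)"
      unfolding reflected[symmetric] word foldl_digit_step_replicate by simp
    ultimately show "n = k 0 \<and> m = 2 ^ n - 1 \<and> stern n m = n \<and> stern n (2 ^ n - m) = 1 \<and>
        stern n (m + 1) = 1 \<and> stern n (2 ^ n - (m + 1)) = 0"
      using n unfolding prod.inject by iprover
  }
qed

end
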